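(* Let $n\ge 13$ with $n/2$ even. A digraph $D$ on $n$ vertices is a $P_{2,2}$-free digraph with exactly $ex(n)=\frac{n^2+4n}{4}$ arcs if and only if $D$ or its reverse $D'$ is isomorphic to a digraph of the following type $D_3$: the vertex set is $\mathcal V_1\cup\mathcal V_2$ (disjoint) with $|\mathcal V_1|=n/2+1$, $|\mathcal V_2|=n/2-1$; there are distinct $y,z\in\mathcal V_1$ and a vertex $v\in\mathcal V_2$; the subdigraph induced on $\mathcal V_1$ is $S(y,z)$; the subdigraph induced on $\mathcal V_2$ consists of $n/4-1$ vertex-disjoint 2-cycles covering $\mathcal V_2\setminus\{v\}$, with $v$ isolated in it; the arcs from $\mathcal V_1$ to $\mathcal V_2$ are the arc $z\to v$ together with a perfect matching from $\mathcal V_1\setminus\{y,z\}$ to $\mathcal V_2$ (each vertex of $\mathcal V_1\setminus\{y,z\}$ has exactly one out-neighbour in $\mathcal V_2$ and each vertex of $\mathcal V_2$ exactly one in-neighbour in $\mathcal V_1\setminus\{y,z\}$), and $y$ has no out-neighbour in $\mathcal V_2$; $v$ has an arc to every vertex of $\mathcal V_1$; every $u\in\mathcal V_2\setminus\{v\}$ has an arc to every vertex of $\mathcal V_1\setminus\{z\}$ and not to $z$. There are no other arcs.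
   Context: All digraphs are strict: no loops and no parallel arcs (2-cycles $u\to w$, $w\to u$ are allowed). $P_{2,2}$ is the digraph on four distinct vertices $a,b,c,d$ with arcs $a\to b$, $b\to d$, $a\to c$, $c\to d$; $P_{2,2}$-free means containing no (not necessarily induced) copy of $P_{2,2}$. $ex(n)$ is the maximum number of arcs of a $P_{2,2}$-free digraph on $n$ vertices. The reverse $D'$ of $D$ is obtained by reversing every arc. For a vertex set $W$ containing distinct vertices $y,z$, $S(y,z)$ denotes the digraph on $W$ with arcs $y\to z$, $z\to y$ and $z\to w$ for every $w\in W\setminus\{y,z\}$, and no other arcs. *)

theory Defs
  imports Main
begin

definition digraph :: "'a set \<Rightarrow> ('a \<times> 'a) set \<Rightarrow> bool" where
  "digraph V A \<longleftrightarrow> finite V \<and> A \<subseteq> V \<times> V \<and> (\<forall>x. (x, x) \<notin> A)"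

definition p22_free :: "('a \<times> 'a) set \<Rightarrow> bool" where
  "p22_free A \<longleftrightarrow> \<not> (\<exists>a b c d. distinct [a, b, c, d] \<and>
      (a, b) \<in> A \<and> (b, d) \<in> A \<and> (a, c) \<in> A \<and> (c, d) \<in> A)"

text \<open>ex(n): maximum number of arcs of a P_{2,2}-free digraph on n vertices
  (vertices taken to be {0..<n}; this is invariant under relabelling).\<close>
definition ex :: "nat \<Rightarrow> nat" where
  "ex n = Max {card A | A. digraph {0..<n} A \<and> p22_free A}"

definition digraph_iso :: "'a set \<Rightarrow> ('a \<times> 'a) set \<Rightarrow> 'b set \<Rightarrow> ('b \<times> 'b) set \<Rightarrow> bool" where
  "digraph_iso V A W B \<longleftrightarrow> (\<exists>f. bij_betw f V W \<and>
      (\<forall>x\<in>V. \<forall>y\<in>V. (x, y) \<in> A \<longleftrightarrow> (f x, f y) \<in> B))"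

definition S_arcs :: "'a set \<Rightarrow> 'a \<Rightarrow> 'a \<Rightarrow> ('a \<times> 'a) set" where
  "S_arcs W y z = {(y, z), (z, y)} \<union> {(z, w) | w. w \<in> W - {y, z}}"

definition is_D3 :: "nat \<Rightarrow> 'a set \<Rightarrow> ('a \<times> 'a) set \<Rightarrow> bool" where
  "is_D3 n W B \<longleftrightarrow> (\<exists>V1 V2 y z v C m.
      W = V1 \<union> V2 \<and> V1 \<inter> V2 = {} \<and> finite V1 \<and> finite V2 \<and>
      card V1 = n div 2 + 1 \<and> card V2 = n div 2 - 1 \<and>
      y \<in> V1 \<and> z \<in> V1 \<and> y \<noteq> z \<and> v \<in> V2 \<and>
      B \<subseteq> W \<times> W \<and>
      \<comment> \<open>induced subdigraph on V1 is S(y,z)\<close>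
      B \<inter> (V1 \<times> V1) = S_arcs V1 y z \<and>
      \<comment> \<open>induced subdigraph on V2: n/4-1 vertex-disjoint 2-cycles covering V2-{v}, v isolated\<close>
      card C = n div 4 - 1 \<and> (\<forall>e\<in>C. card e = 2) \<and>
      (\<forall>e1\<in>C. \<forall>e2\<in>C. e1 \<noteq> e2 \<longrightarrow> e1 \<inter> e2 = {}) \<and>
      \<Union>C = V2 - {v} \<and>
      B \<inter> (V2 \<times> V2) = {(a, b). \<exists>e\<in>C. a \<in> e \<and> b \<in> e \<and> a \<noteq> b} \<and>
      \<comment> \<open>arcs V1 -> V2: z->v plus a perfect matching m from V1-{y,z} onto V2\<close>
      bij_betw m (V1 - {y, z}) V2 \<and>
      B \<inter> (V1 \<times> V2) = {(z, v)} \<union> {(w, m w) | w. w \<in> V1 - {y, z}} \<and>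
      \<comment> \<open>arcs V2 -> V1\<close>
      B \<inter> (V2 \<times> V1) = ({v} \<times> V1) \<union> ((V2 - {v}) \<times> (V1 - {z})))"

end

theory Submission
  imports Defs Complex_Main
begin

text \<open>
  Let \<open>n = 2k\<close>, let \<open>A\<close> have at least \<open>k\<^sup>2 + 2k\<close> arcs, let \<open>u\<close> have the maximum outdegree
  \<open>k + j\<close>, let \<open>N\<close> be its out-neighbourhood and \<open>M\<close> the complement of \<open>N\<close>. The out-neighbourhoods of
  the vertices of \<open>N\<close> are disjoint outside \<open>u\<close>, so \<open>N\<close> sends out at most \<open>n - 1 + r\<close> arcs, where \<open>r\<close> is
  the number of 2-cycles through \<open>u\<close>; each vertex of \<open>M\<close> sends out at most \<open>k + j\<close>. Hence
  \<open>j\<^sup>2 + 1\<close> plus the total loss in these estimates is at most \<open>r\<close>. A vertex of \<open>M\<close> other than \<open>u\<close> hits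
  at most one of the \<open>r\<close> back-neighbours of \<open>u\<close>, so a large \<open>r\<close> forces many arcs inside \<open>M\<close>, while
  two out-neighbours in \<open>M\<close> of a vertex of \<open>M\<close> have disjoint and large out-neighbourhoods in \<open>N\<close>.
  Thus every vertex of \<open>M\<close> has at most one out-neighbour in \<open>M\<close>, \<open>r \<le> 2\<close> and \<open>\<bar>j\<bar> \<le> 1\<close>.

  Reversing all arcs if necessary, no indegree exceeds \<open>k + j\<close>. Counting the arcs that enter \<open>N\<close>
  excludes \<open>j = -1\<close>, and for \<open>j = 0\<close> it makes every vertex of \<open>N\<close> a vertex of maximum indegree; the
  same analysis of the reverse then puts two 2-cycles through each of them, which is too many arcs
  out of \<open>N\<close>. For \<open>j = 1\<close> all estimates are tight and the structure can be read off with
  \<open>V1 = N\<close>, \<open>V2 = M\<close> and \<open>v = u\<close>.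
\<close>

section \<open>Midpoints of 2-paths, reversal, counting arcs\<close>

text \<open>The working form of freeness: distinct ends determine the midpoint of a 2-path.\<close>

lemma p22_freeD:
  assumes "p22_free A" "\<forall>x. (x, x) \<notin> A" "(a, b) \<in> A" "(b, d) \<in> A" "(a, c) \<in> A" "(c, d) \<in> A" "a \<noteq> d"
  shows "b = c"
proof (rule ccontr)
  assume "b \<noteq> c"
  then have "distinct [a, b, c, d]" using assms by auto
  then show False using assms unfolding p22_free_def by blast
qed

lemma digraph_converse: "digraph V A \<Longrightarrow> digraph V (A\<inverse>)"
  unfolding digraph_def by auto

lemma p22_free_converse: "p22_free A \<Longrightarrow> p22_free (A\<inverse>)"
  unfolding p22_free_def by simp metis

lemma card_arcs_eq_sum:
  assumes "digraph V A"
  shows "card A = (\<Sum>x\<in>V. card (A `` {x}))"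
proof -
  have fin: "finite V" "finite A" and "A = Sigma V (\<lambda>x. A `` {x})"
    using assms unfolding digraph_def by (auto intro: finite_subset)
  then have "card A = card (Sigma V (\<lambda>x. A `` {x}))" by simp
  then show ?thesis using fin by simp
qed

lemma sum_card_eq_card_UN:
  assumes "finite I" "finite X" "\<And>i. i \<in> I \<Longrightarrow> F i \<subseteq> X"
    and "\<And>i j x. i \<in> I \<Longrightarrow> j \<in> I \<Longrightarrow> x \<in> F i \<Longrightarrow> x \<in> F j \<Longrightarrow> i = j"
  shows "(\<Sum>i\<in>I. card (F i)) = card (\<Union>i\<in>I. F i)"
  using assms by (intro card_UN_disjoint[symmetric]) (blast intro: finite_subset)+

section \<open>Arc counts around a vertex of maximum outdegree\<close>

text \<open>\<open>many\<close> is a lower bound, so that the classification also yields the value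
  of \<open>ex\<close>. The centre \<open>u\<close> is a parameter so that the locale can be
  instantiated again for the reverse digraph.\<close>

locale extremal =
  fixes V :: "'a set" and A :: "('a \<times> 'a) set" and k :: nat and u :: 'a
  assumes dig: "digraph V A" and free: "p22_free A" and cV: "card V = 2 * k" and k8: "8 \<le> k"
    and many: "k\<^sup>2 + 2 * k \<le> card A" and uV: "u \<in> V"
    and maxdeg: "\<And>x. x \<in> V \<Longrightarrow> card (A `` {x}) \<le> card (A `` {u})"
begin

definition "N = A `` {u}"
definition "M = V - N"
definition "R = {b \<in> N. (b, u) \<in> A}"
definition "inM x = card (A `` {x} \<inter> M)"
text \<open>The truncated subtraction is exact on \<open>V\<close>, as \<open>u\<close> has maximum
  outdegree.\<close>

definition "deficit x = card N - card (A `` {x})"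
definition "deficits = (\<Sum>x\<in>M. deficit x)"
text \<open>\<open>u\<close> is left out because the arcs from \<open>N\<close> to \<open>u\<close>
  are counted by \<open>R\<close>.\<close>

definition "unreached = card (V - {u} - A `` N)"
definition "j = int (card N) - int k"

lemma fin: "finite V" and AV: "A \<subseteq> V \<times> V" and irr: "(x, x) \<notin> A"
  using dig unfolding digraph_def by auto

lemma finA: "finite A" using fin AV by (auto intro: finite_subset)

lemma uniq: "(a, b) \<in> A \<Longrightarrow> (b, d) \<in> A \<Longrightarrow> (a, c) \<in> A \<Longrightarrow> (c, d) \<in> A \<Longrightarrow> a \<noteq> d \<Longrightarrow> b = c"
  using p22_freeD[OF free] irr by blast

lemma finite_sets [simp]: "finite N" "finite M" "finite R" "finite (A `` X)"
proof -
  show "finite N" "finite (A `` X)" using finA unfolding N_def by auto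
  then show "finite R" unfolding R_def by auto
  show "finite M" using fin unfolding M_def by auto
qed

lemma NV: "N \<subseteq> V" and uM: "u \<in> M" and uN: "u \<notin> N" and MV: "M \<subseteq> V" and RN: "R \<subseteq> N"
  using AV uV irr unfolding N_def M_def R_def by auto

lemma cN: "int (card N) = k + j" unfolding j_def by simp

lemma cM: "int (card M) = k - j"
proof -
  have "card M = 2 * k - card N" "card N \<le> 2 * k"
    using card_Diff_subset[of N V] card_mono[OF fin NV] cV NV unfolding M_def by auto
  then show ?thesis unfolding j_def by simp
qed

lemma cR: "int (card R) \<le> k + j"
  using card_mono[OF _ RN] cN by auto

lemma deg: "x \<in> V \<Longrightarrow> int (card (A `` {x})) = k + j - deficit x"
  using maxdeg[of x] unfolding deficit_def N_def[symmetric] j_def by simp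

lemma deg_split:
  assumes "x \<in> V" shows "int (card (A `` {x} \<inter> N)) = k + j - deficit x - inM x"
proof -
  have "A `` {x} = (A `` {x} \<inter> N) \<union> (A `` {x} \<inter> M)" using AV unfolding M_def by auto
  then have "card (A `` {x}) = card (A `` {x} \<inter> N) + inM x"
    unfolding inM_def
    by (subst card_Un_disjoint[symmetric]) (auto simp: M_def fin)
  then show ?thesis using deg[OF assms] by linarith
qed

lemma inM_u: "inM u = 0"
  unfolding inM_def M_def N_def by auto

text \<open>A common out-neighbour other than \<open>u\<close> of two vertices of \<open>N\<close>
  would close a \<open>P_{2,2}\<close> starting at \<open>u\<close>. Arcs back to \<open>u\<close>
  contribute \<open>card R\<close>.\<close>

lemma sum_deg_N: "int (\<Sum>b\<in>N. card (A `` {b})) = card R + 2 * int k - 1 - unreached"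
proof -
  have "(\<Sum>b\<in>N. card (A `` {b})) = (\<Sum>b\<in>N. card (A `` {b} - {u}) + (if b \<in> R then 1 else 0))"
  proof (rule sum.cong)
    fix b assume "b \<in> N"
    show "card (A `` {b}) = card (A `` {b} - {u}) + (if b \<in> R then 1 else 0)"
    proof (cases "(b, u) \<in> A")
      case True
      then have "card (A `` {b}) = Suc (card (A `` {b} - {u}))"
        by (metis Image_singleton_iff card_Suc_Diff1 finite_sets(4))
      then show ?thesis using True \<open>b \<in> N\<close> unfolding R_def by simp
    qed (auto simp: R_def)
  qed simp
  also have "\<dots> = (\<Sum>b\<in>N. card (A `` {b} - {u})) + card R"
    using RN by (simp add: sum.distrib sum.If_cases inf.absorb2)
  also have "(\<Sum>b\<in>N. card (A `` {b} - {u})) = card (\<Union>b\<in>N. A `` {b} - {u})"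
    by (rule sum_card_eq_card_UN[of _ V]) (use AV fin uniq in \<open>auto simp: N_def\<close>)
  also have "(\<Union>b\<in>N. A `` {b} - {u}) = A `` N - {u}" by auto
  finally have 1: "(\<Sum>b\<in>N. card (A `` {b})) = card (A `` N - {u}) + card R" .
  have "V - {u} = (A `` N - {u}) \<union> (V - {u} - A `` N)" using AV by auto
  then have "card (V - {u}) = card (A `` N - {u}) + unreached"
    unfolding unreached_def using fin by (subst card_Un_disjoint[symmetric]) auto
  then have "int (2 * k) - 1 = int (card (A `` N - {u})) + int unreached"
    using uV cV k8 fin by (simp add: of_nat_diff)
  then show ?thesis using 1 by simp
qed

lemma sum_deg_M: "int (\<Sum>x\<in>M. card (A `` {x})) = (k - j) * (k + j) - deficits"
proof -
  have "int (\<Sum>x\<in>M. card (A `` {x})) = (\<Sum>x\<in>M. k + j - deficit x)"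
    using deg MV by (simp add: subset_iff)
  then show ?thesis unfolding deficits_def by (simp add: sum_subtractf cM)
qed

text \<open>Without losses, \<open>N\<close> and \<open>M\<close> together send out
  \<open>card R + 2 * k - 1 + k\<^sup>2 - j\<^sup>2\<close> arcs; this is compared with
  \<open>many\<close>.\<close>

lemma main_ineq: "j\<^sup>2 + 1 + unreached + deficits \<le> card R"
proof -
  have "V = N \<union> M" "N \<inter> M = {}" using NV unfolding M_def by auto
  then have "card A = (\<Sum>b\<in>N. card (A `` {b})) + (\<Sum>x\<in>M. card (A `` {x}))"
    using card_arcs_eq_sum[OF dig] sum.union_disjoint[OF finite_sets(1,2)] by metis
  then have "int (card A) = card R + 2 * int k - 1 - unreached + ((k - j) * (k + j) - deficits)"
    using sum_deg_N sum_deg_M by simp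
  moreover have "int k ^ 2 + 2 * int k \<le> int (card A)"
    using many by (metis of_nat_add of_nat_le_iff of_nat_mult of_nat_numeral of_nat_power)
  ultimately show ?thesis by (simp add: algebra_simps power2_eq_square)
qed

section \<open>Few arcs inside \<open>M\<close>\<close>

text \<open>Two out-neighbours of \<open>x\<close> in \<open>R\<close> would give two 2-paths from
  \<open>x\<close> to \<open>u\<close>. So \<open>x\<close> skips at least \<open>card R - 1\<close>
  vertices of \<open>N\<close>, which shows up as arcs into \<open>M\<close> or as deficit.\<close>

lemma R_hit:
  assumes "x \<in> M" "x \<noteq> u"
  shows "card (A `` {x} \<inter> R) \<le> 1" "int (card R) \<le> inM x + 1 + deficit x"
proof -
  show 1: "card (A `` {x} \<inter> R) \<le> 1"
  proof -
    have "\<forall>a\<in>A `` {x} \<inter> R. \<forall>b\<in>A `` {x} \<inter> R. a = b"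
      using uniq[of x _ u] assms unfolding R_def by auto
    then show ?thesis by (simp add: card_le_Suc0_iff_eq)
  qed
  have "A `` {x} \<inter> N \<subseteq> (N - R) \<union> (A `` {x} \<inter> R)" by auto
  then have "card (A `` {x} \<inter> N) \<le> card (N - R) + card (A `` {x} \<inter> R)"
    by (meson card_Un_le card_mono finite_Diff finite_Int finite_UnI finite_sets order_trans)
  moreover have "int (card (N - R)) = card N - int (card R)"
    using RN by (simp add: card_Diff_subset card_mono of_nat_diff)
  ultimately show "int (card R) \<le> inM x + 1 + deficit x"
    using 1 deg_split[of x] assms MV cN by force
qed

lemma sum_deficit_le: "Y \<subseteq> M \<Longrightarrow> (\<Sum>y\<in>Y. deficit y) \<le> deficits"
  unfolding deficits_def by (rule sum_mono2) auto

text \<open>Out-neighbours of \<open>x\<close> in \<open>M\<close> have out-neighbourhoods that are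
  disjoint apart from \<open>x\<close> itself, hence the \<open>- 1\<close>, and these fit into
  \<open>V - {x}\<close>.\<close>

lemma inM_bound1:
  assumes "x \<in> M"
  shows "inM x * (k + j - 1) \<le> 2 * int k - 1 + deficits"
proof -
  let ?Y = "A `` {x} \<inter> M"
  have "(\<Sum>y\<in>?Y. card (A `` {y} - {x})) = card (\<Union>y\<in>?Y. A `` {y} - {x})"
    by (rule sum_card_eq_card_UN[of _ V]) (use AV fin uniq in auto)
  also have "\<dots> \<le> card (V - {x})"
    by (rule card_mono) (use AV fin in auto)
  also have "\<dots> = 2 * k - 1" using cV fin MV assms by auto
  finally have a: "int (\<Sum>y\<in>?Y. card (A `` {y} - {x})) \<le> 2 * int k - 1" using k8 by linarith
  have "(\<Sum>y\<in>?Y. k + j - 1 - int (deficit y)) \<le> (\<Sum>y\<in>?Y. int (card (A `` {y} - {x})))"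
  proof (rule sum_mono)
    fix y assume "y \<in> ?Y"
    then have "y \<in> V" using MV by auto
    have "card (A `` {y}) \<le> card (A `` {y} - {x}) + 1"
      using card_Diff_singleton_if[of "A `` {y}" x] by (simp split: if_splits)
    then show "k + j - 1 - int (deficit y) \<le> card (A `` {y} - {x})"
      using deg[OF \<open>y \<in> V\<close>] by linarith
  qed
  then have "inM x * (k + j - 1) - int (\<Sum>y\<in>?Y. deficit y) \<le> 2 * int k - 1"
    using a by (simp add: sum_subtractf inM_def)
  moreover have "int (\<Sum>y\<in>?Y. deficit y) \<le> deficits" using sum_deficit_le[of ?Y] of_nat_mono by blast
  ultimately show ?thesis by linarith
qed

text \<open>The weaker first bound survives large \<open>deficits\<close>; it makes \<open>inM\<close> at most 3, so that the quadratic
  term in the second bound becomes harmless.\<close>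

lemma inM_bound2:
  assumes "x \<in> M" "\<And>y. y \<in> M \<Longrightarrow> inM y \<le> inM x"
  shows "inM x * (k + j) \<le> (k + j) + deficits + inM x * inM x"
proof -
  let ?Y = "A `` {x} \<inter> M"
  have "(\<Sum>y\<in>?Y. card (A `` {y} \<inter> N)) = card (\<Union>y\<in>?Y. A `` {y} \<inter> N)"
  proof (rule sum_card_eq_card_UN[of _ N])
    fix a b d assume "a \<in> ?Y" "b \<in> ?Y" "d \<in> A `` {a} \<inter> N" "d \<in> A `` {b} \<inter> N"
    \<comment> \<open>The ends differ because \<open>x\<close> lies in \<open>M\<close> and
      \<open>d\<close> in \<open>N\<close>, so nothing has to be removed from the
      neighbourhoods.\<close>
    then show "a = b" using uniq[of x a d b] assms(1) by (auto simp: M_def)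
  qed auto
  also have "\<dots> \<le> card N" by (rule card_mono) auto
  finally have a: "(\<Sum>y\<in>?Y. int (card (A `` {y} \<inter> N))) \<le> k + j"
    unfolding cN[symmetric] by (simp flip: of_nat_sum)
  have "(\<Sum>y\<in>?Y. k + j - int (inM x) - int (deficit y)) \<le> (\<Sum>y\<in>?Y. int (card (A `` {y} \<inter> N)))"
  proof (rule sum_mono)
    fix y assume "y \<in> ?Y"
    then show "k + j - int (inM x) - int (deficit y) \<le> int (card (A `` {y} \<inter> N))"
      using deg_split[of y] MV assms(2)[of y] by auto
  qed
  then have "inM x * (k + j - int (inM x)) - int (\<Sum>y\<in>?Y. deficit y) \<le> k + j"
    using a by (simp add: sum_subtractf inM_def)
  moreover have "int (\<Sum>y\<in>?Y. deficit y) \<le> deficits" using sum_deficit_le[of ?Y] of_nat_mono by blast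
  ultimately show ?thesis by (simp add: algebra_simps del: of_nat_sum)
qed

text \<open>Averaging over \<open>M - {u}\<close>; \<open>u\<close> is excluded because
  \<open>R_hit\<close> does not apply to it.\<close>

lemma small_deficit:
  assumes "int deficits < c * (int (card M) - 1)" "c \<ge> 0"
  shows "\<exists>x\<in>M - {u}. int (deficit x) < c"
proof (rule ccontr)
  assume "\<not> ?thesis"
  then have "(\<Sum>x\<in>M - {u}. c) \<le> (\<Sum>x\<in>M - {u}. int (deficit x))"
    by (intro sum_mono) force
  also have "\<dots> = int (\<Sum>x\<in>M - {u}. deficit x)" by simp
  also have "\<dots> \<le> deficits" using sum_deficit_le[of "M - {u}"] by (metis Diff_subset of_nat_le_iff)
  finally have "int (card M - 1) * c \<le> deficits" using uM by simp
  moreover have "int (card M - 1) = int (card M) - 1"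
    using uM by (metis One_nat_def Suc_leI card_gt_0_iff empty_iff finite_sets(2) of_nat_1 of_nat_diff)
  ultimately show False using assms by (simp add: mult.commute)
qed

text \<open>A bootstrap on the largest value \<open>m\<close> of \<open>inM\<close>. The crude bound
  gives \<open>m \<le> 3\<close>; a vertex of deficit at most 1 gives
  \<open>card R \<le> m + 2\<close>, which makes \<open>deficits\<close> small enough for the second
  bound to exclude 2 and 3; finally a vertex of deficit 0 gives
  \<open>card R \<le> m + 1\<close>.\<close>

lemma inM_le_1: "x \<in> M \<Longrightarrow> inM x \<le> 1"
  and card_R_le: "card R \<le> 2"
proof -
  have K: "int k \<ge> 8" using k8 by simp
  have "Max (inM ` M) \<in> inM ` M" using uM by (intro Max_in) auto
  then obtain x where x: "x \<in> M" "inM x = Max (inM ` M)" by force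
  have mx: "\<And>y. y \<in> M \<Longrightarrow> inM y \<le> inM x" using x(2) by simp
  define m where "m = int (inM x)"
  have D: "int deficits \<le> int (card R) - 1 - j * j"
    using main_ineq by (simp add: power2_eq_square)
  \<comment> \<open>Linear arithmetic treats \<open>j * j\<close> as an atom, so quadratic facts are
    supplied: squares here, and below products of consecutive integers.\<close>
  have "0 \<le> (j + 1) * (j + 1)" "0 \<le> (j - 1) * (j - 1)" "0 \<le> (j - 2) * (j - 2)" by auto
  then have sq: "0 \<le> j * j + 2 * j + 1" "0 \<le> j * j - 2 * j + 1" "0 \<le> j * j - 4 * j + 4"
    by (auto simp: algebra_simps)
  have jj: "0 \<le> j * j + j" "0 \<le> j * j + 3 * j + 2"
  proof -
    have "0 \<le> j * (j + 1)" "0 \<le> (j + 1) * (j + 2)" by (auto simp: zero_le_mult_iff)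
    then show "0 \<le> j * j + j" "0 \<le> j * j + 3 * j + 2" by (auto simp: algebra_simps)
  qed
  have b1: "m * (k + j - 1) \<le> 2 * int k - 1 + deficits"
    using inM_bound1[OF x(1)] unfolding m_def by simp
  have b2: "m * (k + j) \<le> k + j + deficits + m * m"
    using inM_bound2[OF x(1) mx] unfolding m_def by simp
  have pos: "k + j - 1 \<ge> 0" using main_ineq cR by (smt (verit) of_nat_0_le_iff zero_le_power2)
  have m3: "m \<le> 3"
  proof (rule ccontr)
    assume "\<not> m \<le> 3"
    then have "4 * (k + j - 1) \<le> m * (k + j - 1)" using pos by (intro mult_right_mono) auto
    then have "4 * (k + j - 1) \<le> 2 * int k - 1 + deficits" using b1 by (rule order_trans)
    \<comment> \<open>With \<open>card R \<le> k + j\<close> this gives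
      \<open>k + j * j + 3 * j \<le> 2\<close>, hence \<open>k \<le> 4\<close>.\<close>
    then show False using D cR jj K by (smt (verit))
  qed
  have "int deficits < 2 * (int (card M) - 1)"
    using D cR cM sq K by (smt (verit))
  then obtain x1 where x1: "x1 \<in> M" "x1 \<noteq> u" "int (deficit x1) < 2"
    using small_deficit[of 2] by auto
  then have r1: "int (card R) \<le> m + 2" using R_hit(2)[of x1] mx[of x1] unfolding m_def by linarith
  have m_cases: "m = 0 \<or> m = 1 \<or> m = 2 \<or> m = 3" using m3 unfolding m_def by linarith
  then have m1: "m \<le> 1"
  proof (elim disjE)
    \<comment> \<open>The bounds reduce to \<open>k + j + j * j \<le> 7\<close> here and to
      \<open>2 * k + 2 * j + j * j \<le> 13\<close> in the next case. Both are contradictory for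
      \<open>k = 8\<close> but not for \<open>k = 7\<close>.\<close>
    assume "m = 2"
    then show ?thesis using b2 D r1 jj K by simp
  next
    assume "m = 3"
    then show ?thesis using b2 D r1 sq K by simp
  qed auto
  then show "x \<in> M \<Longrightarrow> inM x \<le> 1" for x using mx[of x] unfolding m_def by linarith
  have "int deficits < 1 * (int (card M) - 1)"
    using D r1 m1 cM jj sq K by (smt (verit))
  then obtain x0 where x0: "x0 \<in> M" "x0 \<noteq> u" "int (deficit x0) < 1"
    using small_deficit[of 1] by auto
  then show "card R \<le> 2" using R_hit(2)[of x0] mx[of x0] m1 unfolding m_def by linarith
qed

lemma j_cases: "j = -1 \<or> j = 0 \<or> j = 1"
proof -
  have "j\<^sup>2 \<le> 1" using main_ineq card_R_le by linarith
  then have "\<bar>j\<bar> \<le> 1" using abs_square_le_1 by blast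
  then show ?thesis by auto
qed

section \<open>Arcs entering \<open>N\<close>, and the reverse digraph\<close>

text \<open>By \<open>inM_le_1\<close> each vertex of \<open>M\<close> other than \<open>u\<close>
  spends at most one arc inside \<open>M\<close>, and \<open>u\<close> spends none. The arcs inside
  \<open>N\<close> reach every vertex of \<open>N\<close> except unreached ones.\<close>

lemma sum_indeg_N:
  "int (\<Sum>w\<in>N. card (A\<inverse> `` {w})) \<ge> k\<^sup>2 - j\<^sup>2 + 2 * j + 1 - deficits - unreached"
proof -
  have *: "(\<Sum>x\<in>X. card (A `` {x} \<inter> N)) = (\<Sum>w\<in>N. card (A\<inverse> `` {w} \<inter> X))" if "finite X" for X
  proof -
    have "(\<Sum>x\<in>X. card (A `` {x} \<inter> N)) = card (SIGMA x:X. A `` {x} \<inter> N)"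
      using that by simp
    also have "\<dots> = card ((SIGMA w:N. A\<inverse> `` {w} \<inter> X)\<inverse>)"
      by (rule arg_cong[of _ _ card]) auto
    also have "\<dots> = (\<Sum>w\<in>N. card (A\<inverse> `` {w} \<inter> X))"
      using that by simp
    finally show ?thesis .
  qed
  have "(\<Sum>w\<in>N. card (A\<inverse> `` {w})) = (\<Sum>w\<in>N. card (A\<inverse> `` {w} \<inter> M) + card (A\<inverse> `` {w} \<inter> N))"
  proof (rule sum.cong)
    fix w
    have "A\<inverse> `` {w} = (A\<inverse> `` {w} \<inter> M) \<union> (A\<inverse> `` {w} \<inter> N)" using AV unfolding M_def by auto
    then have "card (A\<inverse> `` {w}) = card ((A\<inverse> `` {w} \<inter> M) \<union> (A\<inverse> `` {w} \<inter> N))" by simp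
    also have "\<dots> = card (A\<inverse> `` {w} \<inter> M) + card (A\<inverse> `` {w} \<inter> N)"
      by (rule card_Un_disjoint) (auto simp: M_def fin)
    finally show "card (A\<inverse> `` {w}) = card (A\<inverse> `` {w} \<inter> M) + card (A\<inverse> `` {w} \<inter> N)" .
  qed simp
  also have "\<dots> = (\<Sum>x\<in>M. card (A `` {x} \<inter> N)) + (\<Sum>x\<in>N. card (A `` {x} \<inter> N))"
    by (simp add: sum.distrib *)
  finally have 1: "(\<Sum>w\<in>N. card (A\<inverse> `` {w})) = \<dots>" .
  have "(\<Sum>x\<in>M. k + j - deficit x - (if x = u then 0 else 1)) \<le> (\<Sum>x\<in>M. int (card (A `` {x} \<inter> N)))"
  proof (rule sum_mono)
    fix x assume "x \<in> M"
    then show "k + j - deficit x - (if x = u then 0 else 1) \<le> int (card (A `` {x} \<inter> N))"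
      using deg_split[of x] MV inM_le_1[of x] inM_u by auto
  qed
  moreover have "(\<Sum>x\<in>M. k + j - deficit x - (if x = u then 0 else 1)) = (k - j) * (k + j) - deficits - (k - j - 1)"
  proof -
    have "(\<Sum>x\<in>M. if x = u then 0 else (1::int)) = k - j - 1"
    proof -
      have "(\<Sum>x\<in>M. if x = u then 0 else (1::int)) = (\<Sum>x\<in>M. 1 - (if x = u then 1 else 0))"
        by (rule sum.cong) auto
      also have "\<dots> = k - j - 1" using uM by (simp add: sum_subtractf cM)
      finally show ?thesis .
    qed
    then show ?thesis by (simp add: sum_subtractf cM deficits_def)
  qed
  moreover have "int (\<Sum>x\<in>N. card (A `` {x} \<inter> N)) \<ge> k + j - unreached"
  proof -
    have "(\<Sum>x\<in>N. card (A `` {x} \<inter> N)) = card (\<Union>x\<in>N. A `` {x} \<inter> N)"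
      by (rule sum_card_eq_card_UN[of _ N]) (use uniq[of u] irr[of u] in \<open>auto simp: N_def\<close>)
    moreover have "card N \<le> card (\<Union>x\<in>N. A `` {x} \<inter> N) + unreached"
    proof -
      have "card N \<le> card ((\<Union>x\<in>N. A `` {x} \<inter> N) \<union> (V - {u} - A `` N))"
        by (rule card_mono) (use NV uN fin in auto)
      also have "\<dots> \<le> card (\<Union>x\<in>N. A `` {x} \<inter> N) + unreached"
        unfolding unreached_def by (rule card_Un_le)
      finally show ?thesis .
    qed
    ultimately show ?thesis using cN by linarith
  qed
  ultimately show ?thesis using 1 by (simp add: power2_eq_square algebra_simps)
qed

text \<open>The arcs entering \<open>N\<close> are compared with the ceiling
  \<open>card N * card N\<close>. For \<open>j = -1\<close> the ceiling is too low by about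
  \<open>2 * k\<close>; for \<open>j = 0\<close> it can only be met with equality.\<close>

lemma indeg_bounded:
  assumes "\<And>w. w \<in> V \<Longrightarrow> card (A\<inverse> `` {w}) \<le> card N"
  shows "j = 1 \<or> j = 0 \<and> deficits + unreached = 1 \<and> card R = 2 \<and> (\<forall>w\<in>N. card (A\<inverse> `` {w}) = k)"
proof -
  have K: "int k \<ge> 8" using k8 by simp
  have le: "int (\<Sum>w\<in>N. card (A\<inverse> `` {w})) \<le> (k + j) * (k + j)"
  proof -
    have "(\<Sum>w\<in>N. card (A\<inverse> `` {w})) \<le> (\<Sum>w\<in>N. card N)"
      using assms NV by (intro sum_mono) auto
    then have "(\<Sum>w\<in>N. card (A\<inverse> `` {w})) \<le> card N * card N" by simp
    then have "int (\<Sum>w\<in>N. card (A\<inverse> `` {w})) \<le> int (card N) * int (card N)"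
      by (simp only: of_nat_le_iff flip: of_nat_mult)
    then show ?thesis unfolding cN .
  qed
  have r: "j * j + 1 + unreached + deficits \<le> 2"
    using main_ineq card_R_le by (simp add: power2_eq_square)
  have s: "k * k - j * j + 2 * j + 1 - deficits - unreached \<le> (k + j) * (k + j)"
    using sum_indeg_N le by (simp add: power2_eq_square)
  consider "j = -1" | "j = 0" | "j = 1" using j_cases by blast
  then show ?thesis
  proof cases
    case 1
    then show ?thesis using r s K by (simp add: algebra_simps)
  next
    case 2
    then have D: "deficits + unreached = 1" using r s by simp
    then have "card R = 2" using main_ineq card_R_le 2 by simp
    moreover have "card (A\<inverse> `` {w}) = k" if "w \<in> N" for w
    proof (rule ccontr)
      assume "card (A\<inverse> `` {w}) \<noteq> k"
      have N: "card N = k" using 2 cN by simp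
      then have "card (A\<inverse> `` {w}) < k"
        using assms[of w] \<open>card (A\<inverse> `` {w}) \<noteq> k\<close> that NV by force
      then have "(\<Sum>w\<in>N. card (A\<inverse> `` {w})) < (\<Sum>w\<in>N. k)"
        using that assms NV N by (intro sum_strict_mono_ex1) auto
      then have "(\<Sum>w\<in>N. card (A\<inverse> `` {w})) < k * k" using N by simp
      then have "int (\<Sum>w\<in>N. card (A\<inverse> `` {w})) < int k * int k"
        by (simp only: of_nat_less_iff flip: of_nat_mult)
      then show False using sum_indeg_N 2 D by (simp add: power2_eq_square)
    qed
    ultimately show ?thesis using D 2 by blast
  qed auto
qed

text \<open>For \<open>j = 0\<close> the reverse digraph, centred at any vertex of \<open>N\<close>,
  shows that all outdegrees on \<open>N\<close> are at least 2. One vertex \<open>q\<close> of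
  \<open>N\<close> has nearly \<open>k\<close> out-neighbours, and the total contradicts
  \<open>sum_deg_N\<close>.\<close>

lemma j_eq_1_of_indeg_bounded:
  assumes indeg: "\<And>w. w \<in> V \<Longrightarrow> card (A\<inverse> `` {w}) \<le> card N"
  shows "j = 1"
proof (rule ccontr)
  assume "j \<noteq> 1"
  with indeg_bounded[OF indeg] have j0: "j = 0" and D: "deficits + unreached = 1" and R2: "card R = 2"
    and eq: "\<And>w. w \<in> N \<Longrightarrow> card (A\<inverse> `` {w}) = k" by auto
  have N: "card N = k" using j0 cN by simp
  have two: "2 \<le> card (A `` {w})" if w: "w \<in> N" for w
  proof -
    interpret rev: extremal V "A\<inverse>" k w
      using digraph_converse[OF dig] p22_free_converse[OF free] cV k8 many w NV indeg eq[OF w] N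
      by unfold_locales auto
    have rN: "card rev.N = k" unfolding rev.N_def using eq[OF w] .
    then have "rev.j = 0" unfolding rev.j_def by simp
    moreover have "\<And>x. x \<in> V \<Longrightarrow> card ((A\<inverse>)\<inverse> `` {x}) \<le> card rev.N"
      using maxdeg rN N by (simp add: N_def)
    ultimately have "card rev.R = 2" using rev.indeg_bounded by auto
    moreover have "rev.R \<subseteq> A `` {w}" unfolding rev.R_def by auto
    ultimately show ?thesis by (metis card_mono finite_sets(4))
  qed
  have "int deficits < 1 * (int (card M) - 1)" using D cM j0 k8 by simp
  then obtain x where x: "x \<in> M" "x \<noteq> u" "deficit x = 0" using small_deficit[of 1] by auto
  then have ix: "inM x = 1" using R_hit(2)[of x] R2 inM_le_1[of x] by simp
  then obtain x' where x': "x' \<in> M" "(x, x') \<in> A"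
    unfolding inM_def by (metis Image_singleton_iff IntE card_1_singletonE insertI1)
  have "card (A `` {x} \<inter> N) = k - 1" using deg_split[of x] x ix j0 MV k8 by auto
  then have "card (N - A `` {x}) = 1"
    using card_Int_Diff[of N "A `` {x}"] N k8 by (simp add: Int_commute)
  then obtain q where q: "N - A `` {x} = {q}" by (auto simp: card_1_singleton_iff)
  let ?P = "A `` {x'} \<inter> N"
  have "deficit x' \<le> deficits" using sum_deficit_le[of "{x'}"] x' by simp
  then have P: "int k - 2 \<le> card ?P" using deg_split[of x'] inM_le_1[of x'] x' MV j0 D by force
  \<comment> \<open>\<open>x\<close> hits all of \<open>N\<close> but \<open>q\<close>. An
    in-neighbour in \<open>N\<close> of \<open>w\<close>, if different from \<open>q\<close>, would
    be a second midpoint between \<open>x\<close> and \<open>w\<close> besides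
    \<open>x'\<close>.\<close>
  have "?P \<subseteq> A `` {q} \<union> (V - {u} - A `` N)"
  proof
    fix w assume w: "w \<in> ?P"
    show "w \<in> A `` {q} \<union> (V - {u} - A `` N)"
    proof (cases "w \<in> A `` N")
      case True
      then obtain b where b: "b \<in> N" "(b, w) \<in> A" by auto
      have "b = q"
      proof (rule ccontr)
        assume "b \<noteq> q"
        then have "(x, b) \<in> A" using b q by auto
        then have "b = x'" using uniq[of x b w x'] b x' w x(1) unfolding M_def by auto
        then show False using b x' unfolding M_def by auto
      qed
      then show ?thesis using b by auto
    qed (use w NV uN in auto)
  qed
  then have "card ?P \<le> card (A `` {q} \<union> (V - {u} - A `` N))" by (intro card_mono) (auto simp: fin)
  also have "\<dots> \<le> card (A `` {q}) + unreached" unfolding unreached_def by (rule card_Un_le)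
  finally have dq: "int k - 3 \<le> card (A `` {q})" using P D by linarith
  have qN: "q \<in> N" using q by auto
  have "(\<Sum>b\<in>N - {q}. 2) \<le> (\<Sum>b\<in>N - {q}. card (A `` {b}))" using two by (intro sum_mono) auto
  then have "2 * (k - 1) + card (A `` {q}) \<le> (\<Sum>b\<in>N. card (A `` {b}))"
    using sum.remove[OF _ qN, of "\<lambda>b. card (A `` {b})"] N qN by simp
  \<comment> \<open>The sum is at least \<open>2 * (k - 1) + (k - 3)\<close> but at most
    \<open>2 * k + 1\<close>.\<close>
  then show False using sum_deg_N R2 dq k8 by linarith
qed

section \<open>The structure for \<open>j = 1\<close>\<close>

text \<open>\<open>main_ineq\<close> and \<open>card R \<le> 2\<close> leave no loss at all. The
  vertex \<open>z\<close> emerges as the one missed by all of \<open>M - {u}\<close>, and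
  \<open>y\<close> as its in-neighbour in \<open>N\<close>.\<close>

lemma D3_of_j_eq_1:
  assumes j1: "j = 1"
  shows "is_D3 (2 * k) V A"
proof -
  have R2: "card R = 2" and D0: "deficits = 0" and unr0: "unreached = 0"
    using main_ineq card_R_le j1 by auto
  have cN1: "card N = k + 1" and cM1: "card M = k - 1" using cN cM j1 k8 by auto
  have d0: "deficit x = 0" if "x \<in> M" for x using sum_deficit_le[of "{x}"] that D0 by simp
  have reach: "\<exists>b\<in>N. (b, w) \<in> A" if "w \<in> V" "w \<noteq> u" for w
    using unr0 that fin unfolding unreached_def by auto
  have in_uniq: "b = c" if "b \<in> N" "c \<in> N" "(b, w) \<in> A" "(c, w) \<in> A" "w \<noteq> u" for b c w
    using uniq[of u b w c] that unfolding N_def by auto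
  have inM1: "inM x = 1" if "x \<in> M" "x \<noteq> u" for x
    using R_hit(2)[OF that] R2 inM_le_1[OF that(1)] d0[OF that(1)] by simp
  define f where "f x = (THE y. y \<in> M \<and> (x, y) \<in> A)" for x
  have f_ex1: "\<exists>!y. y \<in> M \<and> (x, y) \<in> A" if x: "x \<in> M" "x \<noteq> u" for x
  proof -
    obtain y where "A `` {x} \<inter> M = {y}"
      using inM1[OF x] unfolding inM_def One_nat_def card_1_singleton_iff by blast
    then have "z \<in> M \<and> (x, z) \<in> A \<longleftrightarrow> z = y" for z by auto
    then show ?thesis by auto
  qed
  have f: "f x \<in> M" "(x, f x) \<in> A" if "x \<in> M" "x \<noteq> u" for x
    using theI'[OF f_ex1[OF that]] unfolding f_def by auto
  have f_eq: "f x = y" if "x \<in> M" "x \<noteq> u" "y \<in> M" "(x, y) \<in> A" for x y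
    using f_ex1[OF that(1,2)] f[OF that(1,2)] that by auto
  have missed_ex: "\<exists>q\<in>R. N - A `` {x} = {q}" if x: "x \<in> M" "x \<noteq> u" for x
  proof -
    have "card (A `` {x} \<inter> N) = k"
      using deg_split[of x] inM1[OF x] d0[OF x(1)] x j1 MV by auto
    then have "card (N - A `` {x}) = 1"
      using card_Int_Diff[of N "A `` {x}"] cN1 by (simp add: Int_commute)
    then obtain q where q: "N - A `` {x} = {q}" by (auto simp: card_1_singleton_iff)
    \<comment> \<open>\<open>R\<close> has two vertices and \<open>x\<close> hits at most one of
      them.\<close>
    have "q \<in> R"
    proof (rule ccontr)
      assume "q \<notin> R"
      then have "A `` {x} \<inter> R = R" using q RN by auto
      then show False using R_hit(1)[OF x] R2 by simp
    qed
    then show ?thesis using q by auto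
  qed
  \<comment> \<open>A vertex \<open>b\<close> hit by \<open>x\<close> and pointing to
    \<open>w\<close> would be a second midpoint besides \<open>f x\<close>.\<close>
  have missed_in: "b \<notin> A `` {x}"
    if "x \<in> M" "x \<noteq> u" "w \<in> N" "(f x, w) \<in> A" "b \<in> N" "(b, w) \<in> A" for x w b
  proof
    assume "b \<in> A `` {x}"
    then have "b = f x" using uniq[of x b w "f x"] that f[of x] unfolding M_def by auto
    then show False using f[of x] that unfolding M_def by auto
  qed
  \<comment> \<open>If \<open>f x = u\<close>, then \<open>f x\<close> hits all of \<open>N\<close>,
    so the in-neighbour in \<open>N\<close> of the missed vertex \<open>q\<close> is itself missed
    by \<open>x\<close>, and \<open>q\<close> would have a loop.\<close>
  have fu: "f x \<noteq> u" if x: "x \<in> M" "x \<noteq> u" for x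
  proof
    assume fx: "f x = u"
    obtain q where q: "q \<in> N" "N - A `` {x} = {q}" using missed_ex[OF x] RN by auto
    then obtain b where b: "b \<in> N" "(b, q) \<in> A" using reach[of q] NV uN by auto
    then have "b \<notin> A `` {x}" using missed_in[OF x q(1) _ b] q(1) fx by (simp add: N_def)
    then have "b = q" using b q by blast
    then show False using b irr by auto
  qed
  have "\<not> M \<subseteq> {u}" using card_mono[of "{u}" M] cM1 k8 by auto
  then obtain x0 where x0: "x0 \<in> M" "x0 \<noteq> u" by auto
  obtain z where z: "z \<in> R" "N - A `` {x0} = {z}" using missed_ex[OF x0] by auto
  have zN: "z \<in> N" using z RN by auto
  have third: "\<exists>w\<in>N. w \<noteq> a \<and> w \<noteq> b" for a b
  proof (rule ccontr)
    assume "\<not> ?thesis"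
    then have "N \<subseteq> {a, b}" by auto
    from card_mono[OF _ this] show False using cN1 k8 card_insert_le_m1[of 2 "{b}" a] by simp
  qed
  \<comment> \<open>Choose \<open>w\<close> in \<open>N\<close> hit by both \<open>f x\<close> and
    \<open>f x0\<close>: its in-neighbour in \<open>N\<close> is missed by both \<open>x\<close> and
    \<open>x0\<close>.\<close>
  have missed: "N - A `` {x} = {z}" if x: "x \<in> M" "x \<noteq> u" for x
  proof -
    obtain q where q: "N - A `` {x} = {q}" using missed_ex[OF x] by auto
    obtain q1 where q1: "N - A `` {f x} = {q1}" using missed_ex[OF f(1)[OF x] fu[OF x]] by auto
    obtain q2 where q2: "N - A `` {f x0} = {q2}" using missed_ex[OF f(1)[OF x0] fu[OF x0]] by auto
    obtain w where w: "w \<in> N" "w \<noteq> q1" "w \<noteq> q2" using third by blast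
    obtain b where b: "b \<in> N" "(b, w) \<in> A" using reach[of w] w NV uN by auto
    have "b \<notin> A `` {x}" using missed_in[OF x w(1) _ b] w q1 by auto
    moreover have "b \<notin> A `` {x0}" using missed_in[OF x0 w(1) _ b] w q2 by auto
    ultimately have "b = q" "b = z" using q z b by blast+
    then show ?thesis using q by simp
  qed
  have MtoN: "(x, w) \<in> A \<longleftrightarrow> w \<noteq> z" if "x \<in> M" "x \<noteq> u" "w \<in> N" for x w
    using missed[OF that(1,2)] that(3) by auto
  have utoN: "(u, w) \<in> A \<longleftrightarrow> w \<in> N" for w unfolding N_def by simp
  have z_sub: "(N - {z}) \<union> {u} \<subseteq> A `` {z}"
  proof -
    have "(z, w) \<in> A" if w: "w \<in> N" "w \<noteq> z" for w
    proof -
      obtain b where b: "b \<in> N" "(b, w) \<in> A" using reach[of w] w NV uN by auto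
      have "(f x0, w) \<in> A" using MtoN[OF f(1)[OF x0] fu[OF x0]] w by simp
      then have "b \<notin> A `` {x0}" using missed_in[OF x0 w(1) _ b] by simp
      then have "b = z" using b z by blast
      then show ?thesis using b by simp
    qed
    then show ?thesis using z(1) unfolding R_def by auto
  qed
  \<comment> \<open>The known out-neighbours already exhaust the maximum outdegree
    \<open>k + 1\<close>.\<close>
  have z_out: "A `` {z} = (N - {z}) \<union> {u}"
  proof (rule card_seteq[symmetric])
    have "card ((N - {z}) \<union> {u}) = k + 1" using zN uN cN1 by simp
    then show "card (A `` {z}) \<le> card ((N - {z}) \<union> {u})"
      using maxdeg[of z] zN NV cN1 by (auto simp: N_def)
  qed (use z_sub in auto)
  obtain y where y: "y \<in> N" "(y, z) \<in> A" using reach[of z] zN NV uN by auto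
  have yz: "y \<noteq> z" using y irr by auto
  have NN: "(b, w) \<in> A \<longleftrightarrow> (b = y \<and> w = z) \<or> (b = z \<and> w \<noteq> z)" if "b \<in> N" "w \<in> N" for b w
  proof (cases "w = z")
    case True
    then show ?thesis using in_uniq[of b y z] that y zN uN yz by auto
  next
    case False
    then have "(z, w) \<in> A" using z_out that by auto
    then show ?thesis using in_uniq[of b z w] that zN uN False by auto
  qed
  have Mto: "(x, w) \<in> A" if "x \<in> M" "w \<in> N" "w \<noteq> z" for x w
    using that MtoN[of x w] utoN[of w] by (cases "x = u") auto
  \<comment> \<open>Otherwise \<open>x\<close> and \<open>z\<close> are two midpoints between
    \<open>y\<close> and a third vertex of \<open>N\<close>.\<close>
  have y_M: "(y, x) \<notin> A" if x: "x \<in> M" for x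
  proof
    assume "(y, x) \<in> A"
    obtain w where w: "w \<in> N" "w \<noteq> y" "w \<noteq> z" using third by blast
    then have "x = z"
      using uniq[of y x w z] \<open>(y, x) \<in> A\<close> Mto[OF x] y NN[of z w] zN by auto
    then show False using x zN unfolding M_def by auto
  qed
  \<comment> \<open>All of \<open>M\<close> points to \<open>y\<close>, so two out-neighbours of
    \<open>w\<close> in \<open>M\<close> are two midpoints between \<open>w\<close> and
    \<open>y\<close>.\<close>
  have rest_uniq: "x = x'" if "w \<in> N - {y, z}" "x \<in> M" "x' \<in> M" "(w, x) \<in> A" "(w, x') \<in> A" for w x x'
    using uniq[of w x y x'] that Mto[of x y] Mto[of x' y] y yz by auto
  have rest_ex: "\<exists>w\<in>N - {y, z}. (w, x) \<in> A" if x: "x \<in> M" for x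
  proof (cases "x = u")
    case True
    \<comment> \<open>\<open>reach\<close> says nothing about \<open>u\<close>; the second element
      of \<open>R\<close> serves instead.\<close>
    have "\<not> R \<subseteq> {z}" using R2 card_mono[of "{z}" R] by auto
    then obtain b where "b \<in> R" "b \<noteq> z" by auto
    then show ?thesis using y_M[of u] uM True unfolding R_def by auto
  next
    case False
    then obtain b where b: "b \<in> N" "(b, x) \<in> A" using reach[of x] x MV by auto
    have "b \<noteq> y" using y_M[OF x] b by auto
    moreover have "b \<noteq> z" using z_out b False x unfolding M_def by auto
    ultimately show ?thesis using b by auto
  qed
  \<comment> \<open>\<open>M\<close> and \<open>N - {y, z}\<close> both have \<open>k - 1\<close>
    elements, so an injective choice of in-neighbours is a bijection; its inverse is the
    matching.\<close>
  define g where "g x = (SOME w. w \<in> N - {y, z} \<and> (w, x) \<in> A)" for x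
  have g: "g x \<in> N - {y, z}" "(g x, x) \<in> A" if "x \<in> M" for x
    using someI_ex[of "\<lambda>w. w \<in> N - {y, z} \<and> (w, x) \<in> A"] rest_ex[OF that] unfolding g_def by auto
  have g_inj: "inj_on g M" using rest_uniq g by (intro inj_onI) metis
  have "card (N - {y, z}) = k - 1" using y zN yz cN1 by (simp add: card_Diff_subset)
  then have "g ` M = N - {y, z}"
    using g(1) card_image[OF g_inj] cM1 by (intro card_subset_eq) auto
  then have g_bij: "bij_betw g M (N - {y, z})" using g_inj unfolding bij_betw_def by simp
  define m where "m = inv_into M g"
  have m_bij: "bij_betw m (N - {y, z}) M" unfolding m_def using g_bij by (rule bij_betw_inv_into)
  have m: "m w \<in> M" "(w, m w) \<in> A" if "w \<in> N - {y, z}" for w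
  proof -
    show mM: "m w \<in> M" using m_bij that by (metis bij_betwE)
    have "g (m w) = w" unfolding m_def using g_bij that by (metis bij_betw_inv_into_right)
    then show "(w, m w) \<in> A" using g(2)[OF mM] by simp
  qed
  \<comment> \<open>Otherwise the in-neighbour \<open>b\<close> of \<open>f (f x)\<close> in
    \<open>N - {y, z}\<close>, which \<open>x\<close> hits, is a second midpoint besides
    \<open>f x\<close>.\<close>
  have ff: "f (f x) = x" if x: "x \<in> M" "x \<noteq> u" for x
  proof (rule ccontr)
    assume ne: "f (f x) \<noteq> x"
    have fx: "f x \<in> M" "f x \<noteq> u" "(x, f x) \<in> A" using f fu x by auto
    have ffx: "f (f x) \<in> M" "f (f x) \<noteq> u" "(f x, f (f x)) \<in> A" using f fu fx by auto
    obtain b where b: "b \<in> N - {y, z}" "(b, f (f x)) \<in> A" using rest_ex[OF ffx(1)] by auto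
    then have "(x, b) \<in> A" using Mto x by auto
    then have "b = f x" using uniq[of x b "f (f x)" "f x"] b fx ffx ne by auto
    then show False using b fx unfolding M_def by auto
  qed
  have f_ne: "f x \<noteq> x" if "x \<in> M" "x \<noteq> u" for x using f[OF that] irr by metis
  define C where "C = (\<lambda>x. {x, f x}) ` (M - {u})"
  have C2: "\<forall>e\<in>C. card e = 2" unfolding C_def using f_ne by fastforce
  have Cdisj: "\<forall>e1\<in>C. \<forall>e2\<in>C. e1 \<noteq> e2 \<longrightarrow> e1 \<inter> e2 = {}"
    unfolding C_def using ff by (auto simp: doubleton_eq_iff) metis+
  have UC: "\<Union>C = M - {u}" unfolding C_def using f fu by auto
  have "finite C" unfolding C_def by simp
  then have "2 * card C = card (\<Union>C)"
    using C2 Cdisj UC by (intro card_partition) auto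
  \<comment> \<open>The count \<open>2 * card C = k - 2\<close> makes \<open>k\<close> even, so the
    division is exact.\<close>
  then have cC: "card C = 2 * k div 4 - 1" using UC uM cM1 k8 by simp
  have MM: "(a, b) \<in> A \<longleftrightarrow> (\<exists>e\<in>C. a \<in> e \<and> b \<in> e \<and> a \<noteq> b)" if "a \<in> M" "b \<in> M" for a b
  proof
    assume ab: "(a, b) \<in> A"
    have au: "a \<noteq> u" using ab that utoN unfolding M_def by auto
    then have "b = f a" using f_eq[of a b] ab that by simp
    then show "\<exists>e\<in>C. a \<in> e \<and> b \<in> e \<and> a \<noteq> b"
      using that au f_ne[OF that(1) au] unfolding C_def by (intro bexI[of _ "{a, f a}"]) auto
  next
    assume "\<exists>e\<in>C. a \<in> e \<and> b \<in> e \<and> a \<noteq> b"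
    then obtain x where x: "x \<in> M" "x \<noteq> u" "a \<in> {x, f x}" "b \<in> {x, f x}" "a \<noteq> b"
      unfolding C_def by auto
    then show "(a, b) \<in> A"
      using f[of x] f[of "f x"] ff[of x] fu[of x] by auto
  qed
  have VNM: "V = N \<union> M" "N \<inter> M = {}" using NV unfolding M_def by auto
  have B1: "A \<inter> (N \<times> N) = S_arcs N y z"
    unfolding S_arcs_def using NN y zN yz by auto
  have B2: "A \<inter> (M \<times> M) = {(a, b). \<exists>e\<in>C. a \<in> e \<and> b \<in> e \<and> a \<noteq> b}"
  proof -
    have "a \<in> M" if "e \<in> C" "a \<in> e" for a e using UC that by auto
    then show ?thesis using MM by auto
  qed
  have B3: "A \<inter> (N \<times> M) = {(z, u)} \<union> {(w, m w) | w. w \<in> N - {y, z}}"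
  proof (rule set_eqI, clarify)
    fix w x
    show "(w, x) \<in> A \<inter> (N \<times> M) \<longleftrightarrow> (w, x) \<in> {(z, u)} \<union> {(w, m w) | w. w \<in> N - {y, z}}"
    proof (cases "w \<in> N - {y, z}")
      case True
      then show ?thesis using rest_uniq[of w x "m w"] m[of w] by auto
    next
      case False
      then show ?thesis using z_out zN uM y_M[of x] unfolding M_def by auto
    qed
  qed
  have B4: "A \<inter> (M \<times> N) = ({u} \<times> N) \<union> ((M - {u}) \<times> (N - {z}))"
    using utoN MtoN uM by auto
  show ?thesis unfolding is_D3_def
  proof (intro exI conjI)
    show "V = N \<union> M" "N \<inter> M = {}" "y \<in> N" "z \<in> N" "y \<noteq> z" "u \<in> M" "A \<subseteq> V \<times> V"
      using VNM y zN yz uM AV by auto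
    show "card N = 2 * k div 2 + 1" "card M = 2 * k div 2 - 1" using cN1 cM1 by auto
  qed (fact B1 B2 B3 B4 cC C2 Cdisj UC m_bij finite_sets(1) finite_sets(2))+
qed

end

text \<open>Reversing if necessary makes the largest outdegree at least the largest indegree, as
  \<open>j_eq_1_of_indeg_bounded\<close> requires.\<close>

lemma D3_of_many_arcs:
  assumes dig: "digraph V A" and free: "p22_free A" and cV: "card V = 2 * k" and k8: "8 \<le> k"
    and many: "k\<^sup>2 + 2 * k \<le> card A"
  shows "is_D3 (2 * k) V A \<or> is_D3 (2 * k) V (A\<inverse>)"
proof -
  have V: "finite V" "V \<noteq> {}" using dig cV k8 unfolding digraph_def by auto
  have *: "is_D3 (2 * k) V B"
    if B: "digraph V B" "p22_free B" "k\<^sup>2 + 2 * k \<le> card B" and u: "u \<in> V"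
      and out: "\<And>x. x \<in> V \<Longrightarrow> card (B `` {x}) \<le> card (B `` {u})"
      and indeg: "\<And>x. x \<in> V \<Longrightarrow> card (B\<inverse> `` {x}) \<le> card (B `` {u})" for B u
  proof -
    interpret extremal V B k u using B cV k8 u out by unfold_locales auto
    show ?thesis using D3_of_j_eq_1[OF j_eq_1_of_indeg_bounded] indeg by (simp add: N_def)
  qed
  have ex: "\<exists>u\<in>V. \<forall>x\<in>V. card (B `` {x}) \<le> card (B `` {u})" for B :: "('a \<times> 'a) set"
  proof -
    have "Max ((\<lambda>x. card (B `` {x})) ` V) \<in> (\<lambda>x. card (B `` {x})) ` V" using V by (intro Max_in) auto
    then obtain u where "u \<in> V" "Max ((\<lambda>x. card (B `` {x})) ` V) = card (B `` {u})" by auto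
    then show ?thesis using V by (metis Max_ge finite_imageI image_eqI)
  qed
  obtain u where u: "u \<in> V" "\<And>x. x \<in> V \<Longrightarrow> card (A `` {x}) \<le> card (A `` {u})" using ex by blast
  obtain w where w: "w \<in> V" "\<And>x. x \<in> V \<Longrightarrow> card (A\<inverse> `` {x}) \<le> card (A\<inverse> `` {w})"
    using ex[of "A\<inverse>"] by blast
  show ?thesis
  proof (cases "card (A\<inverse> `` {w}) \<le> card (A `` {u})")
    case True
    then show ?thesis using *[OF dig free many u] w(2) order_trans by blast
  next
    case False
    then have "card ((A\<inverse>)\<inverse> `` {x}) \<le> card (A\<inverse> `` {w})" if "x \<in> V" for x
      using u(2)[OF that] by simp
    then show ?thesis
      using *[OF digraph_converse[OF dig] p22_free_converse[OF free] _ w] many by simp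
  qed
qed

section \<open>Freeness and arc count of the digraphs \<open>D_3\<close>\<close>

text \<open>Freeness goes by the start \<open>a\<close> of a supposed copy. For the count,
  \<open>z\<close> and the vertices of \<open>V2\<close> have outdegree \<open>k + 1\<close>, all
  others 1.\<close>

lemma is_D3_arcs:
  assumes D: "is_D3 (2 * k) W B" and k: "2 \<le> k"
  shows "digraph W B" and "p22_free B" and "card B = k\<^sup>2 + 2 * k"
proof -
  obtain V1 V2 y z v C m where W: "W = V1 \<union> V2" "V1 \<inter> V2 = {}" "finite V1" "finite V2"
    and c1: "card V1 = k + 1" and c2: "card V2 = k - 1"
    and yz: "y \<in> V1" "z \<in> V1" "y \<noteq> z" and v: "v \<in> V2" and BW: "B \<subseteq> W \<times> W"
    and B11: "B \<inter> (V1 \<times> V1) = S_arcs V1 y z"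
    and C: "\<forall>e\<in>C. card e = 2" "\<forall>e1\<in>C. \<forall>e2\<in>C. e1 \<noteq> e2 \<longrightarrow> e1 \<inter> e2 = {}" "\<Union>C = V2 - {v}"
    and B22: "B \<inter> (V2 \<times> V2) = {(a, b). \<exists>e\<in>C. a \<in> e \<and> b \<in> e \<and> a \<noteq> b}"
    and m: "bij_betw m (V1 - {y, z}) V2"
    and B12: "B \<inter> (V1 \<times> V2) = {(z, v)} \<union> {(w, m w) | w. w \<in> V1 - {y, z}}"
    and B21: "B \<inter> (V2 \<times> V1) = ({v} \<times> V1) \<union> ((V2 - {v}) \<times> (V1 - {z}))"
    using D unfolding is_D3_def by auto
  have disj: "a \<in> V1 \<Longrightarrow> a \<notin> V2" for a using W by auto
  have A11: "(a, b) \<in> B \<longleftrightarrow> a = y \<and> b = z \<or> a = z \<and> b \<noteq> z" if "a \<in> V1" "b \<in> V1" for a b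
  proof -
    have "(a, b) \<in> B \<longleftrightarrow> (a, b) \<in> S_arcs V1 y z" using that B11 by auto
    then show ?thesis using that yz unfolding S_arcs_def by auto
  qed
  have A12: "(a, b) \<in> B \<longleftrightarrow> a = z \<and> b = v \<or> a \<noteq> y \<and> a \<noteq> z \<and> b = m a" if "a \<in> V1" "b \<in> V2" for a b
  proof -
    have "(a, b) \<in> B \<longleftrightarrow> (a, b) \<in> {(z, v)} \<union> {(w, m w) | w. w \<in> V1 - {y, z}}"
      using that B12 by blast
    then show ?thesis using that by auto
  qed
  have A21: "(a, b) \<in> B \<longleftrightarrow> a = v \<or> b \<noteq> z" if "a \<in> V2" "b \<in> V1" for a b
  proof -
    have "(a, b) \<in> B \<longleftrightarrow> (a, b) \<in> ({v} \<times> V1) \<union> ((V2 - {v}) \<times> (V1 - {z}))"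
      using that B21 by blast
    then show ?thesis using that by auto
  qed
  have A22: "(a, b) \<in> B \<longleftrightarrow> (\<exists>e\<in>C. a \<in> e \<and> b \<in> e \<and> a \<noteq> b)" if "a \<in> V2" "b \<in> V2" for a b
    using that B22 by auto
  have v22: "(v, b) \<notin> B" "(b, v) \<notin> B" if "b \<in> V2" for b using A22 that v C(3) by auto
  have partner: "\<exists>p\<in>V2. p \<noteq> a \<and> (\<forall>b\<in>V2. (a, b) \<in> B \<longleftrightarrow> b = p)" if a: "a \<in> V2" "a \<noteq> v" for a
  proof -
    obtain e where e: "e \<in> C" "a \<in> e" using C(3) a by auto
    then obtain r s where "e = {r, s}" "r \<noteq> s" using C(1) unfolding card_2_iff by blast
    then obtain p where p: "e = {a, p}" "p \<noteq> a" using e by auto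
    have pV: "p \<in> V2" using C(3) e p by auto
    have "b = p" if b: "b \<in> V2" "(a, b) \<in> B" for b
    proof -
      obtain e' where e': "e' \<in> C" "a \<in> e'" "b \<in> e'" "a \<noteq> b" using A22 a b by auto
      then have "e' = e" using C(2) e by auto
      then show ?thesis using e' p by auto
    qed
    moreover have "(a, p) \<in> B" using A22[OF a(1) pV] e p by auto
    ultimately show ?thesis using pV p(2) by blast
  qed
  have sym22: "(b, a) \<in> B" if "a \<in> V2" "b \<in> V2" "(a, b) \<in> B" for a b
    using A22 that by auto
  have m_V2: "m w \<in> V2" if "w \<in> V1" "w \<noteq> y" "w \<noteq> z" for w
    using bij_betwE[OF m] that by auto
  have m_inj: "w = w'" if "w \<in> V1" "w \<noteq> y" "w \<noteq> z" "w' \<in> V1" "w' \<noteq> y" "w' \<noteq> z" "m w = m w'" for w w'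
    using bij_betw_imp_inj_on[OF m] that by (auto dest: inj_onD)
  have irr: "(x, x) \<notin> B" for x
  proof
    assume x: "(x, x) \<in> B"
    then have "x \<in> V1 \<or> x \<in> V2" using BW W by auto
    then show False using A11[of x x] A22[of x x] x yz by auto
  qed
  then show dig: "digraph W B" unfolding digraph_def using W BW by auto
  show "p22_free B"
    unfolding p22_free_def
  proof (safe)
    fix a b c d assume d: "distinct [a, b, c, d]"
      and ab: "(a, b) \<in> B" and bd: "(b, d) \<in> B" and ac: "(a, c) \<in> B" and cd: "(c, d) \<in> B"
    have mem: "a \<in> V1 \<or> a \<in> V2" "b \<in> V1 \<or> b \<in> V2" "c \<in> V1 \<or> c \<in> V2" "d \<in> V1 \<or> d \<in> V2"
      using BW W ab bd cd by auto
    \<comment> \<open>\<open>y\<close> points only to \<open>z\<close>, the others only to their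
      images under the injective \<open>m\<close>; so two midpoints in \<open>V1\<close> must
      include \<open>z\<close>.\<close>
    have in1: "b = c" if "b \<in> V1" "c \<in> V1" "b \<noteq> z" "c \<noteq> z"
      using that mem(4) bd cd A11[of b d] A11[of c d] A12[of b d] A12[of c d] m_inj[of b c] by auto
    show False
    proof (cases "a \<in> V1")
      case a1: True
      have az: "a = z"
      proof (rule ccontr)
        assume "a \<noteq> z"
        then have "x = (if a = y then z else m a)" if "(a, x) \<in> B" "x \<in> V1 \<or> x \<in> V2" for x
          using a1 A11[of a x] A12[of a x] that by auto
        then have "b = c" using ab ac mem by metis
        then show False using d by auto
      qed
      have out: "x = v" if "(a, x) \<in> B" "x \<in> V2" for x
        using A12[of a x] a1 az that by auto
      have "b \<in> V2 \<or> c \<in> V2" using in1 d az mem by auto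
      \<comment> \<open>The midpoint \<open>v\<close> forces \<open>d\<close> into
        \<open>V1\<close>, where the other midpoint \<open>t\<close> can only point to
        \<open>z\<close>, which is \<open>a\<close>.\<close>
      moreover have False if "x = v" "(a, t) \<in> B" "t \<in> V1" "(x, d) \<in> B" "(t, d) \<in> B" for x t
      proof -
        have "d \<in> V1" using v22(1)[of d] that mem(4) by auto
        then show False using A11[of t d] that az d irr by auto
      qed
      ultimately show False using out[of b] out[of c] ab ac bd cd mem d by auto
    next
      case False
      then have a2: "a \<in> V2" using mem by auto
      show False
      proof (cases "a = v")
        case True
        then have "b \<in> V1" "c \<in> V1" using v22 ab ac mem by auto
        \<comment> \<open>In \<open>V1\<close> only \<open>z\<close> and the vertex matched to
          \<open>v\<close> share an out-neighbour, namely \<open>v\<close>, which is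
          \<open>a\<close>.\<close>
        then show False using bd cd d mem A11[of b d] A11[of c d] A12[of b d] A12[of c d] m_inj[of b c]
          v22(1)[of d] True by auto
      next
        case False
        obtain p where p: "p \<in> V2" "\<forall>b\<in>V2. (a, b) \<in> B \<longleftrightarrow> b = p" using partner[OF a2 False] by auto
        have nz: "x \<noteq> z" if "(a, x) \<in> B" for x
          using that A21[of a x] a2 False yz by auto
        have "(a, p) \<in> B" using p by blast
        then have "(p, a) \<in> B" "p \<noteq> v" using sym22[OF a2 p(1)] v22(2)[OF a2] by auto
        then have pa: "(p, x) \<in> B \<Longrightarrow> x \<in> V2 \<Longrightarrow> x = a" for x
          using partner[OF p(1)] a2 by metis
        have "b \<in> V2 \<or> c \<in> V2" using in1 d nz ab ac mem by auto
        \<comment> \<open>Inside \<open>V2\<close> the partner \<open>p\<close> points only back to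
          \<open>a\<close>, so \<open>d\<close> lies in \<open>V1 - {z}\<close>; but
          \<open>t\<close> can point inside \<open>V1\<close> only to \<open>z\<close>.\<close>
        moreover have False if "x = p" "(a, t) \<in> B" "t \<in> V1" "(x, d) \<in> B" "(t, d) \<in> B" for x t
        proof -
          have d1: "d \<in> V1" using pa that mem(4) d by auto
          have "p \<noteq> v" using v22(2)[OF a2] p by auto
          then have "d \<noteq> z" using A21[OF p(1) d1] that by auto
          then show False using A11[of t d] that d1 nz[of t] by auto
        qed
        ultimately show False using p ab ac bd cd mem d by auto
      qed
    qed
  qed
  have deg1: "card (B `` {w}) = 1" if "w \<in> V1 - {z}" for w
  proof -
    have "B `` {w} = (if w = y then {z} else {m w})"
    proof (rule set_eqI)
      fix x
      have "(w, x) \<in> B \<Longrightarrow> x \<in> V1 \<or> x \<in> V2" using BW W by auto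
      then show "x \<in> B `` {w} \<longleftrightarrow> x \<in> (if w = y then {z} else {m w})"
        using that yz A11[of w x] A12[of w x] m_V2[of w] by auto
    qed
    then show ?thesis by auto
  qed
  have degz: "card (B `` {z}) = k + 1"
  proof -
    have "B `` {z} = insert v (V1 - {z})"
    proof (rule set_eqI)
      fix x
      have "(z, x) \<in> B \<Longrightarrow> x \<in> V1 \<or> x \<in> V2" using BW W by auto
      then show "x \<in> B `` {z} \<longleftrightarrow> x \<in> insert v (V1 - {z})"
        using v yz A11[of z x] A12[of z x] by auto
    qed
    moreover have "v \<notin> V1 - {z}" "card (V1 - {z}) = k" using disj v c1 yz W(3) by auto
    ultimately show ?thesis using W(3) by simp
  qed
  have deg2: "card (B `` {a}) = k + 1" if a: "a \<in> V2" for a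
  proof (cases "a = v")
    case True
    have "B `` {v} = V1"
    proof (rule set_eqI)
      fix x
      have "(v, x) \<in> B \<Longrightarrow> x \<in> V1 \<or> x \<in> V2" using BW W by auto
      then show "x \<in> B `` {v} \<longleftrightarrow> x \<in> V1" using v A21[of v x] v22 by auto
    qed
    then show ?thesis using True c1 by simp
  next
    case False
    obtain p where p: "p \<in> V2" "\<forall>b\<in>V2. (a, b) \<in> B \<longleftrightarrow> b = p" using partner[OF a False] by auto
    have "B `` {a} = insert p (V1 - {z})"
    proof (rule set_eqI)
      fix x
      have "(a, x) \<in> B \<Longrightarrow> x \<in> V1 \<or> x \<in> V2" using BW W by auto
      then show "x \<in> B `` {a} \<longleftrightarrow> x \<in> insert p (V1 - {z})"
        using a p False A21[of a x] yz disj by auto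
    qed
    moreover have "p \<notin> V1 - {z}" "card (V1 - {z}) = k" using disj p c1 yz W(3) by auto
    ultimately show ?thesis using W(3) by simp
  qed
  have "card B = (\<Sum>x\<in>V1. card (B `` {x})) + (\<Sum>x\<in>V2. card (B `` {x}))"
    unfolding card_arcs_eq_sum[OF dig] W(1) using W by (intro sum.union_disjoint) auto
  also have "(\<Sum>x\<in>V2. card (B `` {x})) = (k - 1) * (k + 1)" using deg2 c2 by simp
  also have "(\<Sum>x\<in>V1. card (B `` {x})) = (k + 1) + k"
    using sum.remove[OF W(3) yz(2), of "\<lambda>x. card (B `` {x})"] degz deg1 c1 W yz by simp
  also have "(k + 1) + k + (k - 1) * (k + 1) = k\<^sup>2 + 2 * k"
    using k by (cases k) (auto simp: power2_eq_square)
  finally show "card B = k\<^sup>2 + 2 * k" .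
qed

section \<open>Isomorphism invariance and existence\<close>

lemma is_D3_iso:
  assumes D: "is_D3 n V A" and iso: "digraph_iso V A W B" and BW: "B \<subseteq> W \<times> W"
  shows "is_D3 n W B"
proof -
  obtain V1 V2 y z v C m where V: "V = V1 \<union> V2" "V1 \<inter> V2 = {}" "finite V1" "finite V2"
    and c1: "card V1 = n div 2 + 1" and c2: "card V2 = n div 2 - 1"
    and yz: "y \<in> V1" "z \<in> V1" "y \<noteq> z" and v: "v \<in> V2" and AV: "A \<subseteq> V \<times> V"
    and A11: "A \<inter> (V1 \<times> V1) = S_arcs V1 y z"
    and C: "card C = n div 4 - 1" "\<forall>e\<in>C. card e = 2"
      "\<forall>e1\<in>C. \<forall>e2\<in>C. e1 \<noteq> e2 \<longrightarrow> e1 \<inter> e2 = {}" "\<Union>C = V2 - {v}"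
    and A22: "A \<inter> (V2 \<times> V2) = {(a, b). \<exists>e\<in>C. a \<in> e \<and> b \<in> e \<and> a \<noteq> b}"
    and m: "bij_betw m (V1 - {y, z}) V2"
    and A12: "A \<inter> (V1 \<times> V2) = {(z, v)} \<union> {(w, m w) | w. w \<in> V1 - {y, z}}"
    and A21: "A \<inter> (V2 \<times> V1) = ({v} \<times> V1) \<union> ((V2 - {v}) \<times> (V1 - {z}))"
    using D unfolding is_D3_def by auto
  obtain f where f: "bij_betw f V W" and fB: "\<And>x y. x \<in> V \<Longrightarrow> y \<in> V \<Longrightarrow> (x, y) \<in> A \<longleftrightarrow> (f x, f y) \<in> B"
    using iso unfolding digraph_iso_def by auto
  have inj: "inj_on f V" and fV: "f ` V = W" using f unfolding bij_betw_def by auto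
  have B: "B = map_prod f f ` A"
  proof (rule set_eqI, clarify)
    fix a b
    show "(a, b) \<in> B \<longleftrightarrow> (a, b) \<in> map_prod f f ` A"
    proof
      assume ab: "(a, b) \<in> B"
      then obtain x x' where "x \<in> V" "x' \<in> V" "a = f x" "b = f x'" using BW fV by auto
      then show "(a, b) \<in> map_prod f f ` A" using fB ab by force
    qed (use AV fB in auto)
  qed
  have inj2: "inj_on (map_prod f f) (V \<times> V)" by (rule map_prod_inj_on[OF inj inj])
  \<comment> \<open>Once \<open>B\<close> is the image of \<open>A\<close>, this carries over all
    four blocks of arcs.\<close>
  have restr: "B \<inter> (f ` X \<times> f ` Y) = map_prod f f ` (A \<inter> (X \<times> Y))" if "X \<subseteq> V" "Y \<subseteq> V" for X Y
  proof -
    have "f ` X \<times> f ` Y = map_prod f f ` (X \<times> Y)" by force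
    moreover have "map_prod f f ` (A \<inter> (X \<times> Y)) = map_prod f f ` A \<inter> map_prod f f ` (X \<times> Y)"
      by (rule inj_on_image_Int[OF inj2]) (use AV that in auto)
    ultimately show ?thesis using B by simp
  qed
  have sub: "V1 \<subseteq> V" "V2 \<subseteq> V" using V by auto
  have feq: "f a = f b \<longleftrightarrow> a = b" if "a \<in> V" "b \<in> V" for a b
    using inj that by (rule inj_on_eq_iff)
  have diff1: "f ` (V1 - {y, z}) = f ` V1 - {f y, f z}" "f ` (V1 - {z}) = f ` V1 - {f z}"
    using inj_on_image_set_diff[OF inj, of V1 "{y, z}"] inj_on_image_set_diff[OF inj, of V1 "{z}"] sub yz by auto
  have diff2: "f ` (V2 - {v}) = f ` V2 - {f v}"
    using inj_on_image_set_diff[OF inj, of V2 "{v}"] sub v by auto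
  define g where "g = inv_into V f"
  have gf: "g (f x) = x" if "x \<in> V" for x unfolding g_def using inj that by simp
  have "bij_betw g (f ` V1 - {f y, f z}) (V1 - {y, z})"
    unfolding diff1[symmetric] using gf sub
    by (intro bij_betw_byWitness[of _ f]) auto
  moreover have "bij_betw f V2 (f ` V2)" using inj sub by (meson bij_betw_imageI inj_on_subset)
  ultimately have bij: "bij_betw (f \<circ> m \<circ> g) (f ` V1 - {f y, f z}) (f ` V2)"
    using m by (meson bij_betw_trans comp_assoc)
  have eC: "e \<subseteq> V" if "e \<in> C" for e using C(4) that sub by auto
  have inj_C: "inj_on ((`) f) C"
    using inj_on_image_eq_iff[OF inj eC eC] by (auto intro: inj_onI)
  have B11: "B \<inter> (f ` V1 \<times> f ` V1) = S_arcs (f ` V1) (f y) (f z)"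
  proof -
    have "map_prod f f ` S_arcs V1 y z = {(f y, f z), (f z, f y)} \<union> {(f z, w) | w. w \<in> f ` (V1 - {y, z})}"
      unfolding S_arcs_def by auto
    then show ?thesis unfolding restr[OF sub(1) sub(1)] A11 diff1 S_arcs_def .
  qed
  have B22: "B \<inter> (f ` V2 \<times> f ` V2) = {(a, b). \<exists>e\<in>(`) f ` C. a \<in> e \<and> b \<in> e \<and> a \<noteq> b}"
  proof -
    have "map_prod f f ` {(a, b). \<exists>e\<in>C. a \<in> e \<and> b \<in> e \<and> a \<noteq> b} =
      {(a, b). \<exists>e\<in>(`) f ` C. a \<in> e \<and> b \<in> e \<and> a \<noteq> b}" (is "?L = ?R")
    proof
      show "?L \<subseteq> ?R"
      proof clarify
        fix x x' e assume e: "e \<in> C" "x \<in> e" "x' \<in> e" "x \<noteq> x'"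
        then have "f x \<noteq> f x'" using feq[of x x'] eC by auto
        then show "\<exists>e\<in>(`) f ` C. f x \<in> e \<and> f x' \<in> e \<and> f x \<noteq> f x'" using e by blast
      qed
      show "?R \<subseteq> ?L"
      proof clarify
        fix e x x' assume "e \<in> C" "x \<in> e" "x' \<in> e" "f x \<noteq> f x'"
        then show "(f x, f x') \<in> ?L" by (intro image_eqI[of _ _ "(x, x')"]) auto
      qed
    qed
    then show ?thesis unfolding restr[OF sub(2) sub(2)] A22 .
  qed
  have B12: "B \<inter> (f ` V1 \<times> f ` V2) =
    {(f z, f v)} \<union> {(w, (f \<circ> m \<circ> g) w) | w. w \<in> f ` V1 - {f y, f z}}"
  proof -
    have "map_prod f f ` ({(z, v)} \<union> {(w, m w) | w. w \<in> V1 - {y, z}}) =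
      {(f z, f v)} \<union> (\<lambda>w. (f w, f (m w))) ` (V1 - {y, z})" by auto
    also have "(\<lambda>w. (f w, f (m w))) ` (V1 - {y, z}) = (\<lambda>w. (w, (f \<circ> m \<circ> g) w)) ` f ` (V1 - {y, z})"
      unfolding image_image using gf sub by (intro image_cong) auto
    also have "\<dots> = {(w, (f \<circ> m \<circ> g) w) | w. w \<in> f ` V1 - {f y, f z}}" unfolding diff1 by auto
    finally show ?thesis unfolding restr[OF sub] A12 .
  qed
  have B21: "B \<inter> (f ` V2 \<times> f ` V1) =
    ({f v} \<times> f ` V1) \<union> ((f ` V2 - {f v}) \<times> (f ` V1 - {f z}))"
  proof -
    have "map_prod f f ` (X \<times> Y) = f ` X \<times> f ` Y" for X Y by force
    then show ?thesis
      unfolding restr[OF sub(2) sub(1)] A21 image_Un diff1[symmetric] diff2[symmetric] by simp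
  qed
  show ?thesis
    unfolding is_D3_def
  proof (intro exI conjI)
    show "W = f ` V1 \<union> f ` V2" using fV V by auto
    show "f ` V1 \<inter> f ` V2 = {}" using inj_on_image_Int[OF inj sub] V by simp
    show "card (f ` V1) = n div 2 + 1" "card (f ` V2) = n div 2 - 1"
      using c1 c2 inj sub by (auto simp: card_image inj_on_subset)
    show "f y \<in> f ` V1" "f z \<in> f ` V1" "f y \<noteq> f z" "f v \<in> f ` V2"
      using yz v feq sub by auto
    show "card ((`) f ` C) = n div 4 - 1" using card_image[OF inj_C] C(1) by simp
    show "\<forall>e\<in>(`) f ` C. card e = 2"
      using C(2) eC inj by (auto simp: card_image inj_on_subset)
    show "\<forall>e1\<in>(`) f ` C. \<forall>e2\<in>(`) f ` C. e1 \<noteq> e2 \<longrightarrow> e1 \<inter> e2 = {}"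
    proof clarify
      fix e1 e2 assume e: "e1 \<in> C" "e2 \<in> C" "f ` e1 \<noteq> f ` e2"
      then have "e1 \<inter> e2 = {}" using C(3) by auto
      then show "f ` e1 \<inter> f ` e2 = {}" using inj_on_image_Int[OF inj eC eC] e by (metis image_empty)
    qed
    show "\<Union> ((`) f ` C) = f ` V2 - {f v}" using C(4) diff2 by (metis image_Union)
    show "finite (f ` V1)" "finite (f ` V2)" using V by auto
  qed (fact BW B11 B22 B12 B21 bij)+
qed

lemma digraph_iso_sym:
  assumes "digraph_iso V A W B"
  shows "digraph_iso W B V A"
proof -
  obtain f where f: "bij_betw f V W" and fB: "\<And>x y. x \<in> V \<Longrightarrow> y \<in> V \<Longrightarrow> (x, y) \<in> A \<longleftrightarrow> (f x, f y) \<in> B"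
    using assms unfolding digraph_iso_def by auto
  have "inv_into V f w \<in> V" "f (inv_into V f w) = w" if "w \<in> W" for w
    using f that by (auto simp: bij_betw_def inv_into_into f_inv_into_f)
  then show ?thesis
    unfolding digraph_iso_def using fB bij_betw_inv_into[OF f] by (intro exI[of _ "inv_into V f"]) auto
qed

lemma is_D3_ex_nat:
  fixes A :: "('a \<times> 'a) set"
  assumes "is_D3 n V A"
  shows "\<exists>(W :: nat set) B. is_D3 n W B \<and> digraph_iso V A W B"
proof -
  have "finite V" and AV: "A \<subseteq> V \<times> V" using assms unfolding is_D3_def by auto
  then obtain f :: "'a \<Rightarrow> nat" where f: "bij_betw f V {0..<card V}" using ex_bij_betw_finite_nat by blast
  have inj: "inj_on f V" using f by (rule bij_betw_imp_inj_on)
  have "(x, y) \<in> A \<longleftrightarrow> (f x, f y) \<in> map_prod f f ` A" if "x \<in> V" "y \<in> V" for x y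
  proof
    assume "(f x, f y) \<in> map_prod f f ` A"
    then obtain x' y' where "(x', y') \<in> A" "f x = f x'" "f y = f y'" by auto
    then show "(x, y) \<in> A" using that AV inj by (metis inj_onD mem_Sigma_iff subsetD)
  qed auto
  then have iso: "digraph_iso V A {0..<card V} (map_prod f f ` A)"
    unfolding digraph_iso_def using f by auto
  moreover have "map_prod f f ` A \<subseteq> {0..<card V} \<times> {0..<card V}"
    using bij_betw_imp_surj_on[OF f] AV by auto
  ultimately show ?thesis using is_D3_iso[OF assms] by blast
qed

text \<open>The witness has \<open>v = 0\<close>, 2-cycles on \<open>{1, 2}\<close>,
  \<open>{3, 4}\<close> and so on, and the shift by \<open>k - 1\<close> as matching. Evenness of
  \<open>k\<close> lets the pairs cover \<open>V2 - {v}\<close>.\<close>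

lemma is_D3_exists:
  assumes "even k" "2 \<le> k"
  shows "\<exists>B. is_D3 (2 * k) {0..<2 * k} B"
proof -
  define V1 V2 y z v where "V1 = {k - 1..<2 * k}" and "V2 = {0..<k - 1}"
    and "y = 2 * k - 2" and "z = 2 * k - 1" and "v = (0 :: nat)"
  define C where "C = (\<lambda>i. {2 * i - 1, 2 * i}) ` {1..<k div 2}"
  define m where "m w = w - (k - 1)" for w
  define B where "B = S_arcs V1 y z \<union> {(a, b). \<exists>e\<in>C. a \<in> e \<and> b \<in> e \<and> a \<noteq> b} \<union>
    ({(z, v)} \<union> {(w, m w) | w. w \<in> V1 - {y, z}}) \<union> (({v} \<times> V1) \<union> ((V2 - {v}) \<times> (V1 - {z})))"
  obtain h where h: "k = 2 * h" "1 \<le> h" using assms by auto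
  have UC: "\<Union>C = V2 - {v}"
  proof
    show "\<Union>C \<subseteq> V2 - {v}" unfolding C_def V2_def v_def using h by auto
    show "V2 - {v} \<subseteq> \<Union>C"
    proof
      fix x assume "x \<in> V2 - {v}"
      then have "(x + 1) div 2 \<in> {1..<k div 2}" "x \<in> {2 * ((x + 1) div 2) - 1, 2 * ((x + 1) div 2)}"
        using h unfolding V2_def v_def by auto
      then show "x \<in> \<Union>C" unfolding C_def by blast
    qed
  qed
  have inj_C: "inj_on (\<lambda>i. {2 * i - 1, 2 * i}) {1..<k div 2 :: nat}"
    by (rule inj_onI) (auto simp: doubleton_eq_iff)
  have disj: "V1 \<inter> V2 = {}" unfolding V1_def V2_def by auto
  have yz: "y \<in> V1" "z \<in> V1" "y \<noteq> z" "v \<in> V2"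
    using assms unfolding V1_def V2_def y_def z_def v_def by auto
  have m: "bij_betw m (V1 - {y, z}) V2"
  proof (rule bij_betw_byWitness[of _ "\<lambda>x. x + (k - 1)"])
  qed (use assms in \<open>auto simp: m_def V1_def V2_def y_def z_def\<close>)
  have mV: "m w \<in> V2" if "w \<in> V1" "w \<noteq> y" "w \<noteq> z" for w using bij_betwE[OF m] that by auto
  have CV: "a \<in> V2" if "e \<in> C" "a \<in> e" for a e using UC that by auto
  have S: "S_arcs V1 y z \<subseteq> V1 \<times> V1" unfolding S_arcs_def using yz by auto
  have "is_D3 (2 * k) {0..<2 * k} B"
    unfolding is_D3_def
  proof (intro exI conjI)
    show "{0..<2 * k} = V1 \<union> V2" unfolding V1_def V2_def by auto
    show "card V1 = 2 * k div 2 + 1" "card V2 = 2 * k div 2 - 1"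
      using assms unfolding V1_def V2_def by auto
    show "card C = 2 * k div 4 - 1" unfolding C_def card_image[OF inj_C] using h by simp
    show "\<forall>e\<in>C. card e = 2" unfolding C_def by auto
    show "\<forall>e1\<in>C. \<forall>e2\<in>C. e1 \<noteq> e2 \<longrightarrow> e1 \<inter> e2 = {}" unfolding C_def by auto presburger+
    have "B \<subseteq> (V1 \<union> V2) \<times> (V1 \<union> V2)" unfolding B_def using S CV mV yz by auto
    moreover have "V1 \<union> V2 = {0..<2 * k}" unfolding V1_def V2_def by auto
    ultimately show "B \<subseteq> {0..<2 * k} \<times> {0..<2 * k}" by simp
    show "B \<inter> (V1 \<times> V1) = S_arcs V1 y z"
      unfolding B_def using S CV mV yz disj by auto
    show "B \<inter> (V2 \<times> V2) = {(a, b). \<exists>e\<in>C. a \<in> e \<and> b \<in> e \<and> a \<noteq> b}"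
      unfolding B_def using S CV mV yz disj by auto
    show "B \<inter> (V1 \<times> V2) = {(z, v)} \<union> {(w, m w) | w. w \<in> V1 - {y, z}}"
      unfolding B_def using S CV mV yz disj by auto
    show "B \<inter> (V2 \<times> V1) = ({v} \<times> V1) \<union> ((V2 - {v}) \<times> (V1 - {z}))"
      unfolding B_def using S CV mV yz disj by auto
  qed (use V1_def V2_def yz disj UC m in auto)
  then show ?thesis by blast
qed

section \<open>The value of \<open>ex\<close> and the extremal digraphs\<close>

theorem theorem2p1:
  fixes V :: "'a set" and A :: "('a \<times> 'a) set" and n :: nat
  assumes "n \<ge> 13" and "even n" and "even (n div 2)"
    and "digraph V A" and "card V = n"
  shows "ex n = (n^2 + 4 * n) div 4 \<and>
    ((p22_free A \<and> card A = ex n) \<longleftrightarrow>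
      ((\<exists>(W :: nat set) B. is_D3 n W B \<and> digraph_iso V A W B) \<or>
       (\<exists>(W :: nat set) B. is_D3 n W B \<and> digraph_iso V (converse A) W B)))"
proof -
  define k where "k = n div 2"
  have n: "n = 2 * k" using assms(2) unfolding k_def by simp
  \<comment> \<open>The bound on \<open>n\<close> alone gives \<open>7 \<le> k\<close>; parity
    raises it to 8.\<close>
  have "k \<noteq> 7" using assms(3) unfolding k_def by auto
  then have k8: "8 \<le> k" and ek: "even k" using assms(1,3) n unfolding k_def by auto
  have quarter: "(n^2 + 4 * n) div 4 = k\<^sup>2 + 2 * k" unfolding n by (simp add: power2_eq_square)
  have D3_free: "p22_free E \<and> card E = k\<^sup>2 + 2 * k" if "is_D3 n U E" for U :: "'b set" and E
    using is_D3_arcs(2,3)[of k U E] that k8 unfolding n by simp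
  \<comment> \<open>A digraph exceeding the bound would be a \<open>D_3\<close> up to reversal, and
    these meet the bound exactly.\<close>
  have bound: "card E \<le> k\<^sup>2 + 2 * k" if "digraph {0..<n} E" "p22_free E" for E
  proof (rule ccontr)
    assume E: "\<not> ?thesis"
    then have "is_D3 n {0..<n} E \<or> is_D3 n {0..<n} (E\<inverse>)"
      using D3_of_many_arcs[of "{0..<n}" E k] that k8 unfolding n by simp
    then have "card E = k\<^sup>2 + 2 * k" using D3_free by fastforce
    then show False using E by simp
  qed
  have ex_n: "ex n = k\<^sup>2 + 2 * k"
    unfolding ex_def
  proof (rule Max_eqI)
    show "finite {card A | A. digraph {0..<n} A \<and> p22_free A}"
      by (rule finite_subset[of _ "{..k\<^sup>2 + 2 * k}"]) (use bound in auto)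
    obtain B where "is_D3 n {0..<n} B" using is_D3_exists[OF ek] k8 unfolding n by auto
    then have "digraph {0..<n} B" "p22_free B" "card B = k\<^sup>2 + 2 * k"
      using is_D3_arcs[of k "{0..<n}" B] k8 unfolding n by auto
    then show "k\<^sup>2 + 2 * k \<in> {card A | A. digraph {0..<n} A \<and> p22_free A}" by force
  qed (use bound in auto)
  \<comment> \<open>By invariance, having an isomorphic model on \<open>nat\<close> amounts to being
    of this type on \<open>V\<close> itself.\<close>
  have iso_D3: "(\<exists>(W :: nat set) B. is_D3 n W B \<and> digraph_iso V E W B) \<longleftrightarrow> is_D3 n V E"
    if "digraph V E" for E
  proof -
    have "E \<subseteq> V \<times> V" using that unfolding digraph_def by blast
    then show ?thesis using is_D3_ex_nat[of n V E] is_D3_iso digraph_iso_sym by blast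
  qed
  have "p22_free A \<and> card A = k\<^sup>2 + 2 * k \<longleftrightarrow> is_D3 n V A \<or> is_D3 n V (A\<inverse>)"
  proof
    assume "p22_free A \<and> card A = k\<^sup>2 + 2 * k"
    then show "is_D3 n V A \<or> is_D3 n V (A\<inverse>)"
      using D3_of_many_arcs[of V A k] assms(4,5) k8 unfolding n by simp
  next
    assume "is_D3 n V A \<or> is_D3 n V (A\<inverse>)"
    then have "p22_free A \<and> card A = k\<^sup>2 + 2 * k \<or> p22_free (A\<inverse>) \<and> card (A\<inverse>) = k\<^sup>2 + 2 * k"
      using D3_free by blast
    then show "p22_free A \<and> card A = k\<^sup>2 + 2 * k" using p22_free_converse[of "A\<inverse>"] by auto
  qed
  then show ?thesis
    unfolding ex_n quarter iso_D3[OF assms(4)] iso_D3[OF digraph_converse[OF assms(4)]] by simp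
qed

end
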